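(* Let $A$ be an associative algebra, $M$ an $A$-bimodule, and $H$ a Hochschild $2$-cocycle of $A$ with coefficients in $M$. A linear map $T:M\to A$ is an $H$-twisted Rota-Baxter operator if and only if $T\in\mathrm{Hom}(M,A)$ is a Maurer-Cartan element in the $L_\infty$-algebra $\big(\bigoplus_{n\ge 0}\mathrm{Hom}(M^{\otimes n},A),\ \llbracket\ ,\ \rrbracket,\ \llbracket\ ,\ ,\ \rrbracket\big)$.
   Context: All vector spaces, linear maps and tensor products are over a field $\mathbb K$ of characteristic $0$. Let $A$ be an associative algebra with product $\mu(a,b)=ab$. An $A$-bimodule is a vector space $M$ with bilinear left and right actions $l(a,u)=a\cdot u$, $r(u,a)=u\cdot a$ satisfying $(ab)\cdot u=a\cdot(b\cdot u)$, $(a\cdot u)\cdot b=a\cdot(u\cdot b)$, $(u\cdot a)\cdot b=u\cdot(ab)$. A Hochschild $2$-cocycle is a bilinear map $H:A^{\otimes 2}\to M$ with $a\cdot H(b,c)-H(ab,c)+H(a,bc)-H(a,b)\cdot c=0$ for all $a,b,c\in A$. A linear map $T:M\to A$ is an $H$-twisted Rota-Baxter operator if $T(u)T(v)=T(u\cdot T(v)+T(u)\cdot v+H(Tu,Tv))$ for all $u,v\in M$. $L_\infty$-algebras: a graded vector space $L=\bigoplus_i L_i$ with graded skew-symmetric multilinear maps $l_k:L^{\otimes k}\to L$ of degree $2-k$, $k\ge1$ (i.e. $l_k(x_{\sigma(1)},\ldots,x_{\sigma(k)})=(-1)^\sigma\epsilon(\sigma)l_k(x_1,\ldots,x_k)$,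 $\epsilon(\sigma)$ the Koszul sign) such that for every $n\ge 1$ $$\sum_{i+j=n+1}\sum_\sigma(-1)^\sigma\epsilon(\sigma)(-1)^{i(j-1)}l_j\big(l_i(x_{\sigma(1)},\ldots,x_{\sigma(i)}),x_{\sigma(i+1)},\ldots,x_{\sigma(n)}\big)=0,$$ $\sigma$ running over $(i,n-i)$-unshuffles, $i\ge 1$. If $l_k=0$ for $k>3$, a Maurer-Cartan element is $\alpha\in L_1$ with $l_1(\alpha)+\frac12 l_2(\alpha,\alpha)-\frac16 l_3(\alpha,\alpha,\alpha)=0$. The brackets: $\mathrm{Hom}(M^{\otimes n},A)$ is placed in degree $n$ (with $\mathrm{Hom}(M^{\otimes 0},A)=A$). Let $V=A\oplus M$ and regard multilinear maps on $A$ and $M$ as multilinear maps on $V$, extended by zero. For $f\in\mathrm{Hom}(V^{\otimes m},V)$, $g\in\mathrm{Hom}(V^{\otimes n},V)$ the classical Gerstenhaber bracket is $[f,g]_{\mathsf G}=f\circ g-(-1)^{(m-1)(n-1)}g\circ f$, where $f\circ g=\sum_{i=1}^m(-1)^{(i-1)(n-1)}f\circ_i g$ and $f\circ_i g$ inserts $g$ in the $i$-th input of $f$. Here $\mu+l+r$ is the map $((a,u),(b,v))\mapsto(ab,a\cdot v+u\cdot b)$. For $P\in\mathrm{Hom}(M^{\otimes p},A)$, $Q\in\mathrm{Hom}(M^{\otimes q},A)$, $R\in\mathrm{Hom}(M^{\otimes r},A)$ (in the exponents and sums below $r$ denotes the arity of $R$), $$\llbracket P,Q\rrbracket=(-1)^p[[\mu+l+r,P]_{\mathsf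 G},Q]_{\mathsf G}$$ (in this formula $r$ is the right action), and the degree $-1$ ternary bracket is $$\begin{aligned} &\llbracket P,Q,R\rrbracket(u_1,\ldots,u_{p+q+r-1})=(-1)^{pqr}\Big\{\\ &\sum_{1\le i\le p}(-1)^{(i-1)q}P\big(u_1,\ldots,u_{i-1},H(Q(u_i,\ldots,u_{i+q-1}),R(u_{i+q},\ldots,u_{i+q+r-1})),\ldots,u_{p+q+r-1}\big)\\ &-(-1)^{qr}\sum_{1\le i\le p}(-1)^{(i-1)r}P\big(u_1,\ldots,u_{i-1},H(R(u_i,\ldots,u_{i+r-1}),Q(u_{i+r},\ldots,u_{i+q+r-1})),\ldots,u_{p+q+r-1}\big)\\ &-(-1)^{pq}\sum_{1\le i\le q}(-1)^{(i-1)p}Q\big(u_1,\ldots,u_{i-1},H(P(u_i,\ldots,u_{i+p-1}),R(u_{i+p},\ldots,u_{i+p+r-1})),\ldots,u_{p+q+r-1}\big)\\ &+(-1)^{p(q+r)}\sum_{1\le i\le q}(-1)^{(i-1)r}Q\big(u_1,\ldots,u_{i-1},H(R(u_i,\ldots,u_{i+r-1}),P(u_{i+r},\ldots,u_{i+p+r-1})),\ldots,u_{p+q+r-1}\big)\\ &-(-1)^{pq+qr+rp}\sum_{1\le i\le r}(-1)^{(i-1)q}R\big(u_1,\ldots,u_{i-1},H(Q(u_i,\ldots,u_{i+q-1}),P(u_{i+q},\ldots,u_{i+p+q-1})),\ldots,u_{p+q+r-1}\big)\\ &+(-1)^{(p+q)r}\sum_{1\le i\le r}(-1)^{(i-1)p}R\big(u_1,\ldots,u_{i-1},H(P(u_i,\ldots,u_{i+p-1}),Q(u_{i+p},\ldots,u_{i+p+q-1})),\ldots,u_{p+q+r-1}\big)\Big\}.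 \end{aligned}$$ The $L_\infty$-algebra has $l_2=\llbracket\ ,\ \rrbracket$, $l_3=\llbracket\ ,\ ,\ \rrbracket$ and all other $l_k=0$. *)

theory Defs
  imports Complex_Main "HOL-Library.Function_Algebras" "HOL-Library.Product_Plus"
begin

section \<open>Associative algebras, bimodules, Hochschild 2-cocycles\<close>

definition bilinear_map ::
    "('k::field \<Rightarrow> 'u::ab_group_add \<Rightarrow> 'u) \<Rightarrow> ('k \<Rightarrow> 'v::ab_group_add \<Rightarrow> 'v) \<Rightarrow>
     ('k \<Rightarrow> 'w::ab_group_add \<Rightarrow> 'w) \<Rightarrow> ('u \<Rightarrow> 'v \<Rightarrow> 'w) \<Rightarrow> bool" where
  "bilinear_map sU sV sW f \<longleftrightarrow>
     (\<forall>u. Vector_Spaces.linear sV sW (\<lambda>v. f u v)) \<and>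
     (\<forall>v. Vector_Spaces.linear sU sW (\<lambda>u. f u v))"

text \<open>Algebras are not assumed to have a unit.\<close>

locale associative_algebra = vector_space sA
  for sA :: "'k::field_char_0 \<Rightarrow> 'a::ab_group_add \<Rightarrow> 'a" +
  fixes mu :: "'a \<Rightarrow> 'a \<Rightarrow> 'a"
  assumes mu_bilinear: "bilinear_map sA sA sA mu"
    and mu_assoc: "mu (mu a b) c = mu a (mu b c)"

locale algebra_bimodule =
  associative_algebra sA mu + M: vector_space sM
  for sA :: "'k::field_char_0 \<Rightarrow> 'a::ab_group_add \<Rightarrow> 'a"
    and mu :: "'a \<Rightarrow> 'a \<Rightarrow> 'a"
    and sM :: "'k \<Rightarrow> 'm::ab_group_add \<Rightarrow> 'm" +
  fixes lact :: "'a \<Rightarrow> 'm \<Rightarrow> 'm"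
    and ract :: "'m \<Rightarrow> 'a \<Rightarrow> 'm"
  assumes lact_bilinear: "bilinear_map sA sM sM lact"
    and ract_bilinear: "bilinear_map sM sA sM ract"
    and lact_mu: "lact (mu a b) u = lact a (lact b u)"
    and lact_ract: "ract (lact a u) b = lact a (ract u b)"
    and ract_mu: "ract (ract u a) b = ract u (mu a b)"

locale hochschild_2_cocycle =
  algebra_bimodule sA mu sM lact ract
  for sA :: "'k::field_char_0 \<Rightarrow> 'a::ab_group_add \<Rightarrow> 'a"
    and mu :: "'a \<Rightarrow> 'a \<Rightarrow> 'a"
    and sM :: "'k \<Rightarrow> 'm::ab_group_add \<Rightarrow> 'm"
    and lact :: "'a \<Rightarrow> 'm \<Rightarrow> 'm"
    and ract :: "'m \<Rightarrow> 'a \<Rightarrow> 'm" +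
  fixes H :: "'a \<Rightarrow> 'a \<Rightarrow> 'm"
  assumes H_bilinear: "bilinear_map sA sA sM H"
    and H_cocycle: "lact a (H b c) - H (mu a b) c + H a (mu b c) - ract (H a b) c = 0"

definition twisted_rota_baxter ::
    "('k::field \<Rightarrow> 'a::ab_group_add \<Rightarrow> 'a) \<Rightarrow> ('a \<Rightarrow> 'a \<Rightarrow> 'a) \<Rightarrow>
     ('k \<Rightarrow> 'm::ab_group_add \<Rightarrow> 'm) \<Rightarrow> ('a \<Rightarrow> 'm \<Rightarrow> 'm) \<Rightarrow> ('m \<Rightarrow> 'a \<Rightarrow> 'm) \<Rightarrow>
     ('a \<Rightarrow> 'a \<Rightarrow> 'm) \<Rightarrow> ('m \<Rightarrow> 'a) \<Rightarrow> bool" where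
  "twisted_rota_baxter sA mu sM lact ract H T \<longleftrightarrow>
     Vector_Spaces.linear sM sA T \<and>
     (\<forall>u v. mu (T u) (T v) = T (ract u (T v) + lact (T u) v + H (T u) (T v)))"

section \<open>The graded space of multilinear maps\<close>

text \<open>
  A \<open>k\<close>-ary map is a function on lists that vanishes on lists of length different from \<open>k\<close>.
  With this convention a function on lists can be the sum of maps of several arities,
  so that \<open>'m list \<Rightarrow> 'a\<close> contains the direct sum over \<open>n\<close> of the spaces of \<open>n\<close>-linear maps.
  For \<open>n = 0\<close> the space is \<open>A\<close>, as only the value at the empty list is free.
\<close>

definition multilinear_maps ::
    "('k::field \<Rightarrow> 'm::ab_group_add \<Rightarrow> 'm) \<Rightarrow> ('k \<Rightarrow> 'a::ab_group_add \<Rightarrow> 'a) \<Rightarrow>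
     nat \<Rightarrow> ('m list \<Rightarrow> 'a) set" where
  "multilinear_maps sM sA n =
     {P. (\<forall>us. length us \<noteq> n \<longrightarrow> P us = 0) \<and>
         (\<forall>us ws. length us + 1 + length ws = n \<longrightarrow>
            Vector_Spaces.linear sM sA (\<lambda>u. P (us @ u # ws)))}"

definition hom_degree ::
    "('k::field \<Rightarrow> 'm::ab_group_add \<Rightarrow> 'm) \<Rightarrow> ('k \<Rightarrow> 'a::ab_group_add \<Rightarrow> 'a) \<Rightarrow>
     int \<Rightarrow> ('m list \<Rightarrow> 'a) set" where
  "hom_degree sM sA i = (if 0 \<le> i then multilinear_maps sM sA (nat i) else {0})"

definition unary :: "('m \<Rightarrow> 'a::zero) \<Rightarrow> 'm list \<Rightarrow> 'a" where
  "unary T us = (case us of [u] \<Rightarrow> T u | _ \<Rightarrow> 0)"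

text \<open>\<open>signed e x\<close> is \<open>(-1)\<^sup>e x\<close>; the exponent is an integer since \<open>n - 1\<close> may be negative.\<close>

definition signed :: "int \<Rightarrow> 'v::ab_group_add \<Rightarrow> 'v" where
  "signed e x = (if even e then x else - x)"

section \<open>The binary bracket\<close>

text \<open>In this section \<open>f\<close> has arity \<open>m\<close>, \<open>g\<close> has arity \<open>n\<close>, and inputs are counted from 1.\<close>

definition insertion ::
    "nat \<Rightarrow> nat \<Rightarrow> ('v list \<Rightarrow> 'v::zero) \<Rightarrow> nat \<Rightarrow> ('v list \<Rightarrow> 'v) \<Rightarrow> 'v list \<Rightarrow> 'v" where
  "insertion i m f n g vs =
     (if length vs + 1 = m + n
      then f (take (i - 1) vs @ g (take n (drop (i - 1) vs)) # drop (i - 1 + n) vs)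
      else 0)"

definition circ ::
    "nat \<Rightarrow> ('v list \<Rightarrow> 'v::ab_group_add) \<Rightarrow> nat \<Rightarrow> ('v list \<Rightarrow> 'v) \<Rightarrow> 'v list \<Rightarrow> 'v" where
  "circ m f n g vs =
     (\<Sum>i = 1..m. signed ((int i - 1) * (int n - 1)) (insertion i m f n g vs))"

definition gerstenhaber ::
    "nat \<Rightarrow> ('v list \<Rightarrow> 'v::ab_group_add) \<Rightarrow> nat \<Rightarrow> ('v list \<Rightarrow> 'v) \<Rightarrow> 'v list \<Rightarrow> 'v" where
  "gerstenhaber m f n g vs =
     circ m f n g vs - signed ((int m - 1) * (int n - 1)) (circ n g m f vs)"

definition mu_l_r ::
    "('a::ab_group_add \<Rightarrow> 'a \<Rightarrow> 'a) \<Rightarrow> ('a \<Rightarrow> 'm::ab_group_add \<Rightarrow> 'm) \<Rightarrow> ('m \<Rightarrow> 'a \<Rightarrow> 'm) \<Rightarrow>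
     ('a \<times> 'm) list \<Rightarrow> 'a \<times> 'm" where
  "mu_l_r mu lact ract vs =
     (case vs of [(a, u), (b, v)] \<Rightarrow> (mu a b, lact a v + ract u b) | _ \<Rightarrow> 0)"

text \<open>
  The two passages between maps \<open>M\<^sup>n \<rightarrow> A\<close> and maps \<open>V\<^sup>n \<rightarrow> V\<close>, where \<open>V = A \<oplus> M\<close>.
\<close>

definition extend_by_zero ::
    "nat \<Rightarrow> ('m list \<Rightarrow> 'a::zero) \<Rightarrow> ('a \<times> 'm::zero) list \<Rightarrow> 'a \<times> 'm" where
  "extend_by_zero n P vs = (if length vs = n then P (map snd vs) else 0, 0)"

definition restrict_to_M ::
    "(('a::zero \<times> 'm) list \<Rightarrow> 'a \<times> 'm) \<Rightarrow> 'm list \<Rightarrow> 'a" where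
  "restrict_to_M F us = fst (F (map (\<lambda>u. (0, u)) us))"

definition binary_bracket ::
    "('a::ab_group_add \<Rightarrow> 'a \<Rightarrow> 'a) \<Rightarrow> ('a \<Rightarrow> 'm::ab_group_add \<Rightarrow> 'm) \<Rightarrow> ('m \<Rightarrow> 'a \<Rightarrow> 'm) \<Rightarrow>
     nat \<Rightarrow> ('m list \<Rightarrow> 'a) \<Rightarrow> nat \<Rightarrow> ('m list \<Rightarrow> 'a) \<Rightarrow> 'm list \<Rightarrow> 'a" where
  "binary_bracket mu lact ract p P q Q us =
     signed (int p)
       (restrict_to_M
          (gerstenhaber (p + 1) (gerstenhaber 2 (mu_l_r mu lact ract) p (extend_by_zero p P))
             q (extend_by_zero q Q)) us)"

section \<open>The ternary bracket\<close>

text \<open>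
  \<open>inner_sum H p P q Q r R\<close> is the sum over \<open>1 \<le> i \<le> p\<close> of
  \<open>(-1)\<^bsup>(i-1)q\<^esup> P(u\<^sub>1, ..., u\<^bsub>i-1\<^esub>, H(Q(u\<^sub>i, ..., u\<^bsub>i+q-1\<^esub>), R(u\<^bsub>i+q\<^esub>, ..., u\<^bsub>i+q+r-1\<^esub>)), ...)\<close>.
  The six sums of the ternary bracket arise from it by permuting the three maps.
\<close>

definition inner_sum ::
    "('a \<Rightarrow> 'a \<Rightarrow> 'm) \<Rightarrow> nat \<Rightarrow> ('m list \<Rightarrow> 'a::ab_group_add) \<Rightarrow> nat \<Rightarrow> ('m list \<Rightarrow> 'a) \<Rightarrow>
     nat \<Rightarrow> ('m list \<Rightarrow> 'a) \<Rightarrow> 'm list \<Rightarrow> 'a" where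
  "inner_sum H p P q Q r R us =
     (\<Sum>i = 1..p. signed ((int i - 1) * int q)
        (P (take (i - 1) us @
            H (Q (take q (drop (i - 1) us))) (R (take r (drop (i - 1 + q) us))) #
            drop (i - 1 + q + r) us)))"

definition ternary_bracket ::
    "('a \<Rightarrow> 'a \<Rightarrow> 'm) \<Rightarrow> nat \<Rightarrow> ('m list \<Rightarrow> 'a::ab_group_add) \<Rightarrow> nat \<Rightarrow> ('m list \<Rightarrow> 'a) \<Rightarrow>
     nat \<Rightarrow> ('m list \<Rightarrow> 'a) \<Rightarrow> 'm list \<Rightarrow> 'a" where
  "ternary_bracket H p P q Q r R us =
     (if length us + 1 = p + q + r then
        signed (int (p * q * r))
          (inner_sum H p P q Q r R us
           - signed (int (q * r)) (inner_sum H p P r R q Q us)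
           - signed (int (p * q)) (inner_sum H q Q p P r R us)
           + signed (int (p * (q + r))) (inner_sum H q Q r R p P us)
           - signed (int (p * q + q * r + r * p)) (inner_sum H r R q Q p P us)
           + signed (int ((p + q) * r)) (inner_sum H r R p P q Q us))
      else 0)"

section \<open>The brackets on the direct sum and Maurer-Cartan elements\<close>

definition component :: "nat \<Rightarrow> ('m list \<Rightarrow> 'a::zero) \<Rightarrow> 'm list \<Rightarrow> 'a" where
  "component n P us = (if length us = n then P us else 0)"

text \<open>
  A family \<open>l\<^sub>1, l\<^sub>2, ...\<close> of brackets is one function \<open>l\<close> on lists of arguments, \<open>l\<^sub>k\<close> being its
  restriction to lists of length \<open>k\<close>. Below, \<open>l\<^sub>2\<close> and \<open>l\<^sub>3\<close> are the multilinear extensions of the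
  binary and ternary brackets from homogeneous elements to the direct sum: the brackets of
  homogeneous elements of degrees \<open>p, q\<close> (and \<open>r\<close>) have arity \<open>p + q\<close> (and \<open>p + q + r - 1\<close>), which
  makes the sums finite at each argument \<open>us\<close>.
\<close>

definition twisted_brackets ::
    "('a::ab_group_add \<Rightarrow> 'a \<Rightarrow> 'a) \<Rightarrow> ('a \<Rightarrow> 'm::ab_group_add \<Rightarrow> 'm) \<Rightarrow> ('m \<Rightarrow> 'a \<Rightarrow> 'm) \<Rightarrow>
     ('a \<Rightarrow> 'a \<Rightarrow> 'm) \<Rightarrow> ('m list \<Rightarrow> 'a) list \<Rightarrow> 'm list \<Rightarrow> 'a" where
  "twisted_brackets mu lact ract H Ps =
     (case Ps of
        [P, Q] \<Rightarrow> (\<lambda>us. \<Sum>(p, q) \<in> {(p, q). p + q = length us}.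
          binary_bracket mu lact ract p (component p P) q (component q Q) us)
      | [P, Q, R] \<Rightarrow> (\<lambda>us. \<Sum>(p, q, r) \<in> {(p, q, r). p + q + r = length us + 1}.
          ternary_bracket H p (component p P) q (component q Q) r (component r R) us)
      | _ \<Rightarrow> 0)"

text \<open>
  Maurer-Cartan elements of a graded space \<open>L\<close> with brackets \<open>l\<close> such that \<open>l\<^sub>k = 0\<close> for \<open>k > 3\<close>.
  The condition refers to the grading and the brackets \<open>l\<^sub>1, l\<^sub>2, l\<^sub>3\<close>, but not the identities
  between them.
\<close>

definition maurer_cartan ::
    "('k::field_char_0 \<Rightarrow> 'v::ab_group_add \<Rightarrow> 'v) \<Rightarrow> (int \<Rightarrow> 'v set) \<Rightarrow> ('v list \<Rightarrow> 'v) \<Rightarrow>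
     'v \<Rightarrow> bool" where
  "maurer_cartan scale L l \<alpha> \<longleftrightarrow>
     \<alpha> \<in> L 1 \<and>
     l [\<alpha>] + scale (1 / 2) (l [\<alpha>, \<alpha>]) - scale (1 / 6) (l [\<alpha>, \<alpha>, \<alpha>]) = 0"

definition pointwise_scale :: "('k \<Rightarrow> 'a \<Rightarrow> 'a) \<Rightarrow> 'k \<Rightarrow> ('x \<Rightarrow> 'a) \<Rightarrow> 'x \<Rightarrow> 'a" where
  "pointwise_scale sA c P = (\<lambda>x. sA c (P x))"

end

theory Submission
  imports Defs
begin

text \<open>
  A linear map \<open>T\<close> has only a component of degree 1, and a bracket with a zero entry is zero.
  Hence the Maurer-Cartan equation lives on \<open>M\<^sup>2\<close>, where expanding the brackets gives
  \<open>\<lbrakk>T, T\<rbrakk>(u, v) = -2 (T u T v - T (u \<cdot> T v + T u \<cdot> v))\<close> and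
  \<open>\<lbrakk>T, T, T\<rbrakk>(u, v) = -6 T (H (T u, T v))\<close>.
\<close>

text \<open>This is the consequence of multilinearity that kills a bracket with a zero entry. It
  mentions neither scalars nor arities, so it passes directly through insertions and Gerstenhaber
  brackets.\<close>

definition vanishes_at_zero :: "('u::zero list \<Rightarrow> 'v::zero) \<Rightarrow> bool" where
  "vanishes_at_zero f \<longleftrightarrow> (\<forall>vs. 0 \<in> set vs \<longrightarrow> f vs = 0)"

lemma vanishes_at_zeroD: "vanishes_at_zero f \<Longrightarrow> 0 \<in> set vs \<Longrightarrow> f vs = 0"
  by (simp add: vanishes_at_zero_def)

lemma signed_0 [simp]: "signed e 0 = 0"
  by (simp add: signed_def)

lemma bilinear_map_0:
  assumes "bilinear_map sU sV sW f"
  shows "f 0 v = 0" "f u 0 = 0"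
proof -
  interpret l: Vector_Spaces.linear sU sW "\<lambda>u. f u v"
    using assms by (simp add: bilinear_map_def)
  interpret r: Vector_Spaces.linear sV sW "\<lambda>v. f u v"
    using assms by (simp add: bilinear_map_def)
  show "f 0 v = 0" "f u 0 = 0"
    by (rule l.zero, rule r.zero)
qed

text \<open>A zero outside the block given to \<open>g\<close> remains an argument of
  \<open>f\<close>. A zero inside the block makes the value of \<open>g\<close> zero, and that value
  is an argument of \<open>f\<close>.\<close>

lemma vanishes_at_zero_insertion:
  assumes "vanishes_at_zero f" "vanishes_at_zero g"
  shows "vanishes_at_zero (insertion i m f n g)"
  unfolding vanishes_at_zero_def
proof (intro allI impI)
  fix vs :: "'a list"
  let ?xs = "take (i - 1) vs" and ?ys = "take n (drop (i - 1) vs)"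
    and ?zs = "drop (i - 1 + n) vs"
  assume "0 \<in> set vs"
  moreover have "vs = ?xs @ ?ys @ ?zs"
    by (metis append_take_drop_id drop_drop add.commute)
  ultimately have "0 \<in> set ?xs \<union> set ?ys \<union> set ?zs"
    by (metis set_append Un_assoc)
  then have "0 \<in> set (?xs @ g ?ys # ?zs)"
    using vanishes_at_zeroD[OF assms(2), of ?ys] by auto
  then show "insertion i m f n g vs = 0"
    by (simp add: insertion_def vanishes_at_zeroD[OF assms(1)])
qed

lemma vanishes_at_zero_circ:
  assumes "vanishes_at_zero f" "vanishes_at_zero g"
  shows "vanishes_at_zero (circ m f n g)"
  using vanishes_at_zero_insertion[OF assms]
  by (auto simp: vanishes_at_zero_def circ_def)

lemma vanishes_at_zero_gerstenhaber:
  assumes "vanishes_at_zero f" "vanishes_at_zero g"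
  shows "vanishes_at_zero (gerstenhaber m f n g)"
  using vanishes_at_zero_circ[OF assms] vanishes_at_zero_circ[OF assms(2,1)]
  by (auto simp: vanishes_at_zero_def gerstenhaber_def)

lemma circ_0:
  assumes "vanishes_at_zero f"
  shows "circ m f n 0 = 0" "circ m 0 n f = 0"
  using assms
  by (auto simp: fun_eq_iff circ_def insertion_def vanishes_at_zero_def intro!: sum.neutral)

lemma gerstenhaber_0:
  assumes "vanishes_at_zero f"
  shows "gerstenhaber m f n 0 = 0" "gerstenhaber m 0 n f = 0"
  using assms by (simp_all add: fun_eq_iff gerstenhaber_def circ_0)

lemma vanishes_at_zero_extend_by_zero:
  fixes P :: "'m::zero list \<Rightarrow> 'a::zero"
  assumes "vanishes_at_zero P"
  shows "vanishes_at_zero (extend_by_zero n P)"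
  unfolding vanishes_at_zero_def
proof (intro allI impI)
  fix vs :: "('a \<times> 'm) list"
  assume "0 \<in> set vs"
  then have "0 \<in> set (map snd vs)"
    by (force simp: zero_prod_def)
  then show "extend_by_zero n P vs = 0"
    using assms by (simp add: extend_by_zero_def vanishes_at_zero_def zero_prod_def)
qed

lemma extend_by_zero_0: "extend_by_zero n 0 = 0"
  by (simp add: fun_eq_iff extend_by_zero_def zero_prod_def)

lemma vanishes_at_zero_unary: "T 0 = 0 \<Longrightarrow> vanishes_at_zero (unary T)"
  by (auto simp: vanishes_at_zero_def unary_def split: list.splits)

lemma component_unary: "component n (unary T) = (if n = 1 then unary T else 0)"
  by (auto simp: fun_eq_iff component_def unary_def split: list.splits)

lemma unary_in_multilinear_maps:
  assumes "Vector_Spaces.linear sM sA T"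
  shows "unary T \<in> multilinear_maps sM sA 1"
  using assms by (auto simp: multilinear_maps_def unary_def split: list.splits)

lemma binary_bracket_0:
  fixes P :: "'m::ab_group_add list \<Rightarrow> 'a::ab_group_add"
  assumes "vanishes_at_zero (mu_l_r mu lact ract)" "vanishes_at_zero P"
  shows "binary_bracket mu lact ract p P q 0 = 0" "binary_bracket mu lact ract p 0 q P = 0"
  by (simp_all add: fun_eq_iff binary_bracket_def extend_by_zero_0 gerstenhaber_0
      vanishes_at_zero_gerstenhaber vanishes_at_zero_extend_by_zero assms restrict_to_M_def)

lemma inner_sum_0:
  assumes "vanishes_at_zero P" "\<And>a. H 0 a = 0" "\<And>a. H a 0 = 0"
  shows "inner_sum H p P q 0 r R = 0" "inner_sum H p P q Q r 0 = 0" "inner_sum H p 0 q Q r R = 0"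
  using assms
  by (auto simp: fun_eq_iff inner_sum_def vanishes_at_zero_def intro!: sum.neutral)

text \<open>In each of the six sums the zero map is either the outer map or inside an argument of
  \<open>H\<close>. In the second case \<open>H\<close> returns zero to an outer map that vanishes
  there.\<close>

lemma ternary_bracket_0:
  assumes "vanishes_at_zero P" "vanishes_at_zero Q" "\<And>a. H 0 a = 0" "\<And>a. H a 0 = 0"
  shows "ternary_bracket H p P q Q r 0 = 0" "ternary_bracket H p P q 0 r Q = 0"
    "ternary_bracket H p 0 q P r Q = 0"
  using assms
  by (auto simp: fun_eq_iff ternary_bracket_def inner_sum_0)

text \<open>As \<open>T\<close> has arity 1, all Gerstenhaber signs are trivial and only the factor
  -1 from \<open>p = 1\<close> remains. With F the inner bracket, the result is -(F(Tu, v) + F(u,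
  Tv) - T F(u, v)). The product of Tu and Tv comes once from each of the first two terms; they also
  give one copy of each action term, and the last term gives the other. Twice is written as a sum
  because no scalars are present here.\<close>

lemma binary_bracket_unary:
  assumes T: "T 0 = 0" "\<And>u v. T (u + v) = T u + T v"
    and m: "\<And>a. mu 0 a = 0" "\<And>a. mu a 0 = 0" "\<And>u. lact 0 u = 0" "\<And>a. lact a 0 = 0"
      "\<And>a. ract 0 a = 0" "\<And>u. ract u 0 = 0"
  shows "binary_bracket mu lact ract 1 (unary T) 1 (unary T) [u, v] =
    - (mu (T u) (T v) - T (ract u (T v) + lact (T u) v)
       + (mu (T u) (T v) - T (ract u (T v) + lact (T u) v)))"
  by (simp add: binary_bracket_def restrict_to_M_def gerstenhaber_def circ_def insertion_def
      mu_l_r_def extend_by_zero_def unary_def signed_def numeral_2_eq_2 T m algebra_simps)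

text \<open>For \<open>p = q = r = 1\<close> the parities cancel the explicit signs, so all six sums
  enter with a plus sign and coincide; the global sign is -1. The sum over \<open>i<6\<close>
  expresses the multiple 6 without scalars.\<close>

lemma ternary_bracket_unary:
  "ternary_bracket H 1 (unary T) 1 (unary T) 1 (unary T) [u, v] =
    - (\<Sum>i<(6::nat). T (H (T u) (T v)))"
  by (simp add: ternary_bracket_def inner_sum_def unary_def signed_def eval_nat_numeral
      lessThan_Suc)

lemma twisted_brackets_unary_2:
  fixes T :: "'m::ab_group_add \<Rightarrow> 'a::ab_group_add"
  assumes "T 0 = 0" "vanishes_at_zero (mu_l_r mu lact ract)"
  shows "twisted_brackets mu lact ract H [unary T, unary T] us =
    (if length us = 2 then binary_bracket mu lact ract 1 (unary T) 1 (unary T) us else 0)"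
proof -
  let ?S = "{(p, q). p + q = length us}"
  let ?f = "\<lambda>(p, q). binary_bracket mu lact ract p (component p (unary T))
    q (component q (unary T)) us"
  have zero: "?f x = 0" if "x \<noteq> (1, 1)" for x
  proof -
    \<comment> \<open>Several components can be zero at once, so the remaining argument of
      \<open>binary_bracket_0\<close> may itself be the zero map.\<close>
    have "vanishes_at_zero (0 :: 'm list \<Rightarrow> 'a)"
      by (simp add: vanishes_at_zero_def)
    then show ?thesis
      using that vanishes_at_zero_unary[of T] assms
      by (cases x) (auto simp: component_unary binary_bracket_0)
  qed
  have "finite ?S"
    by (rule finite_subset[of _ "{..length us} \<times> {..length us}"]) auto
  \<comment> \<open>The intersection is empty unless \<open>length us = 2\<close>; this produces the
    \<open>else\<close> branch.\<close>
  then have "sum ?f ?S = sum ?f (?S \<inter> {(1, 1)})"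
    by (rule sum.mono_neutral_right) (use zero in blast)+
  then show ?thesis
    by (auto simp: twisted_brackets_def component_unary)
qed

lemma twisted_brackets_unary_3:
  fixes T :: "'m::ab_group_add \<Rightarrow> 'a::ab_group_add"
  assumes "T 0 = 0" "\<And>a. H 0 a = 0" "\<And>a. H a 0 = 0"
  shows "twisted_brackets mu lact ract H [unary T, unary T, unary T] us =
    (if length us = 2 then ternary_bracket H 1 (unary T) 1 (unary T) 1 (unary T) us else 0)"
proof -
  let ?S = "{(p, q, r). p + q + r = length us + 1}"
  let ?f = "\<lambda>(p, q, r). ternary_bracket H p (component p (unary T)) q (component q (unary T))
    r (component r (unary T)) us"
  have zero: "?f x = 0" if "x \<noteq> (1, 1, 1)" for x
  proof -
    have "vanishes_at_zero (0 :: 'm list \<Rightarrow> 'a)"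
      by (simp add: vanishes_at_zero_def)
    then show ?thesis
      using that vanishes_at_zero_unary[of T] assms
      by (cases x) (auto simp: component_unary ternary_bracket_0)
  qed
  have "finite ?S"
    by (rule finite_subset[of _ "{..length us + 1} \<times> {..length us + 1} \<times> {..length us + 1}"]) auto
  \<comment> \<open>The ternary bracket has degree -1, so three entries of degree 1 also meet the
    index condition exactly at \<open>length us = 2\<close>.\<close>
  then have "sum ?f ?S = sum ?f (?S \<inter> {(1, 1, 1)})"
    by (rule sum.mono_neutral_right) (use zero in blast)+
  then show ?thesis
    by (auto simp: twisted_brackets_def component_unary)
qed

theorem theorem3p1:
  fixes sA :: "'k::field_char_0 \<Rightarrow> 'a::ab_group_add \<Rightarrow> 'a"
    and mu :: "'a \<Rightarrow> 'a \<Rightarrow> 'a"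
    and sM :: "'k \<Rightarrow> 'm::ab_group_add \<Rightarrow> 'm"
    and lact :: "'a \<Rightarrow> 'm \<Rightarrow> 'm"
    and ract :: "'m \<Rightarrow> 'a \<Rightarrow> 'm"
    and H :: "'a \<Rightarrow> 'a \<Rightarrow> 'm"
    and T :: "'m \<Rightarrow> 'a"
  assumes "associative_algebra sA mu"
    and "algebra_bimodule sA mu sM lact ract"
    and "hochschild_2_cocycle sA mu sM lact ract H"
    and "Vector_Spaces.linear sM sA T"
  shows "twisted_rota_baxter sA mu sM lact ract H T \<longleftrightarrow>
    maurer_cartan (pointwise_scale sA) (hom_degree sM sA)
      (twisted_brackets mu lact ract H) (unary T)"
proof -
  interpret hochschild_2_cocycle sA mu sM lact ract H by fact
  interpret T: Vector_Spaces.linear sM sA T by fact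
  note zeros = bilinear_map_0[OF mu_bilinear] bilinear_map_0[OF lact_bilinear]
    bilinear_map_0[OF ract_bilinear]
  note H_zeros = bilinear_map_0[OF H_bilinear]
  have m: "vanishes_at_zero (mu_l_r mu lact ract)"
    by (auto simp: vanishes_at_zero_def mu_l_r_def zero_prod_def zeros split: list.splits)
  let ?l = "twisted_brackets mu lact ract H"
  \<comment> \<open>The left-hand side of the Maurer-Cartan equation without its
    \<open>l [\<alpha>]\<close> term, which is zero by the default case of
    \<open>twisted_brackets\<close>.\<close>
  let ?E = "\<lambda>us. sA (1 / 2) (?l [unary T, unary T] us) -
    sA (1 / 6) (?l [unary T, unary T, unary T] us)"
  have half: "sA (1 / 2) (- (x + x)) = - x" for x
  proof -
    have "x + x = sA 2 x"
      using scale_left_distrib[of 1 1 x] by simp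
    then show ?thesis
      \<comment> \<open>Distributing the minus sign would break up the sum that is to be replaced by
        \<open>sA 2 x\<close>.\<close>
      by (simp del: minus_add_distrib)
  qed
  have sixth: "sA (1 / 6) (- (\<Sum>i<(6::nat). x)) = - x" for x
    by (simp add: sum_constant_scale)
  have l2: "?l [unary T, unary T] [u, v] =
      - (mu (T u) (T v) - T (ract u (T v) + lact (T u) v)
         + (mu (T u) (T v) - T (ract u (T v) + lact (T u) v)))" for u v
    by (simp add: twisted_brackets_unary_2 T.zero m
        binary_bracket_unary[of T mu lact ract, OF T.zero T.add zeros, unfolded One_nat_def])
  have l3: "?l [unary T, unary T, unary T] [u, v] = - (\<Sum>i<(6::nat). T (H (T u) (T v)))" for u v
    by (simp add: twisted_brackets_unary_3 T.zero H_zeros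
        ternary_bracket_unary[unfolded One_nat_def])
  \<comment> \<open>The minus sign in front of the cubic term cancels the one in \<open>l3\<close>,
    so the \<open>H\<close> term joins the two action terms under \<open>T\<close>.\<close>
  have E2: "?E [u, v] = T (ract u (T v) + lact (T u) v + H (T u) (T v)) - mu (T u) (T v)" for u v
    unfolding l2 l3 half sixth by (simp add: T.add)
  have E0: "?E us = 0" if "length us \<noteq> 2" for us
    using that by (simp add: twisted_brackets_unary_2 twisted_brackets_unary_3 T.zero m H_zeros)
  have "maurer_cartan (pointwise_scale sA) (hom_degree sM sA) ?l (unary T) \<longleftrightarrow> (\<forall>us. ?E us = 0)"
    using unary_in_multilinear_maps[OF assms(4)]
    by (simp add: maurer_cartan_def hom_degree_def pointwise_scale_def fun_eq_iff)
      (simp add: twisted_brackets_def)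
  also have "\<dots> \<longleftrightarrow> (\<forall>u v. ?E [u, v] = 0)"
  proof (intro iffI allI)
    fix us
    assume *: "\<forall>u v. ?E [u, v] = 0"
    show "?E us = 0"
    proof (cases "length us = 2")
      case True
      then obtain u v where "us = [u, v]"
        by (auto simp: numeral_2_eq_2 length_Suc_conv)
      then show ?thesis
        using * by blast
    qed (rule E0)
  qed blast
  also have "\<dots> \<longleftrightarrow> twisted_rota_baxter sA mu sM lact ract H T"
    unfolding E2 twisted_rota_baxter_def using assms(4) by (metis eq_iff_diff_eq_0)
  finally show ?thesis ..
qed

end
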